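(* Let $T$ be a finite tree, $xy\in E(T)$, and let $T^{(\ell)}$, $R_A$, $R_B$, $\Phi_A$, $\Phi_B$ be as defined in the context. Suppose $\lambda_\ell:=\lambda_{\max}(R_{T^{(\ell)}})$ eventually (for all sufficiently large $\ell$) lies in a compact interval $[\lambda_-,\lambda_+]\subset(0,\infty)$. Then every accumulation point $\lambda_\ast$ of the sequence $\{\lambda_\ell\}$ with $\lambda_\ast\notin\sigma(R_A)\cup\sigma(R_B)$ satisfies $$\bigl(\Phi_A(\lambda_\ast)-q(\lambda_\ast)\bigr)\bigl(\Phi_B(\lambda_\ast)-q(\lambda_\ast)\bigr)=0,$$ where $q(\lambda)=1+\lambda-\sqrt{\lambda(\lambda+2)}$.
   Context: For a finite tree $T=(V,E)$ let $d_z$ denote the degree of the vertex $z$. The Ricci matrix $R_T\in\mathbb R^{E\times E}$ is the real symmetric matrix indexed by edges with entries $(R_T)_{e,e}=-\left(\frac1{d_x}+\frac1{d_y}\right)$ for $e=\{x,y\}$, $(R_T)_{e,e'}=\frac1{d_z}$ if $e\ne e'$ and $e\cap e'=\{z\}$, and $(R_T)_{e,e'}=0$ if $e\cap e'=\varnothing$. $\sigma(M)$ denotes the spectrum and $\lambda_{\max}(M)$ the largest eigenvalue of a real symmetric matrix $M$. Fix an edge $xy\in E(T)$. For $\ell\ge 2$, $T^{(\ell)}$ is obtained from $T$ by replacing $xy$ with a path of length $\ell$ from $x$ to $y$ through $\ell-1$ new vertices of degree $2$; $T^{(1)}:=T$. Deleting $xy$ from $T$ leaves two rooted branches: $A$ (containing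 the root $x$) and $B$ (containing the root $y$), with edge sets $E(A),E(B)$. $R_A$ and $R_B$ are the principal submatrices of $R_T$ on $E(A)$ and $E(B)$ (all degrees are those in $T$). Let $s_A\in\mathbb R^{E(A)}$ be the indicator vector of the $d_x-1$ edges of $A$ incident to $x$, let $s_B\in\mathbb R^{E(B)}$ be the indicator vector of the $d_y-1$ edges of $B$ incident to $y$, and put $c_A=\frac1{d_x}s_A$, $c_B=\frac1{d_y}s_B$. For $\lambda\notin\sigma(R_A)\cup\sigma(R_B)$ the feedback functions are $$\Phi_A(\lambda)=2\left(\lambda+\tfrac1{d_x}+\tfrac12-c_A^{T}(\lambda I-R_A)^{-1}c_A\right),\qquad \Phi_B(\lambda)=2\left(\lambda+\tfrac1{d_y}+\tfrac12-c_B^{T}(\lambda I-R_B)^{-1}c_B\right).$$ (If a branch has no edges, its spectrum is empty and the corresponding quadratic term is $0$.) *)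

theory Defs
  imports Complex_Main
begin

text \<open>
  Finite simple graphs are given by a vertex set and a set of two-element edges. Notions that do
  not depend on isolated vertices take the edge set only.
\<close>

definition simple_graph :: "'a set \<Rightarrow> 'a set set \<Rightarrow> bool" where
  "simple_graph V E \<longleftrightarrow> finite V \<and> (\<forall>e\<in>E. e \<subseteq> V \<and> card e = 2)"

definition reachable :: "'a set set \<Rightarrow> 'a \<Rightarrow> 'a \<Rightarrow> bool" where
  "reachable E u v \<longleftrightarrow> (u, v) \<in> {(a, b). {a, b} \<in> E}\<^sup>*"

definition is_cycle :: "'a set set \<Rightarrow> 'a list \<Rightarrow> bool" where
  "is_cycle E vs \<longleftrightarrow> 3 \<le> length vs \<and> distinct vs \<and>
     (\<forall>i. Suc i < length vs \<longrightarrow> {vs ! i, vs ! Suc i} \<in> E) \<and> {last vs, hd vs} \<in> E"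

definition is_tree :: "'a set \<Rightarrow> 'a set set \<Rightarrow> bool" where
  "is_tree V E \<longleftrightarrow> simple_graph V E \<and> V \<noteq> {} \<and>
     (\<forall>u\<in>V. \<forall>v\<in>V. reachable E u v) \<and> (\<nexists>vs. is_cycle E vs)"

definition deg :: "'a set set \<Rightarrow> 'a \<Rightarrow> nat" where
  "deg E z = card {e \<in> E. z \<in> e}"

text \<open>
  Real matrices with rows and columns indexed by a finite set \<open>S\<close> are functions of two arguments,
  of which only the values on \<open>S \<times> S\<close> matter; a principal submatrix is the same function
  considered on a smaller index set. The spectrum consists of the real eigenvalues, which for
  symmetric matrices are all of them.
\<close>

definition spectrum_on :: "'i set \<Rightarrow> ('i \<Rightarrow> 'i \<Rightarrow> real) \<Rightarrow> real set" where
  "spectrum_on S M = {l. \<exists>v. (\<exists>i\<in>S. v i \<noteq> 0) \<and> (\<forall>i\<in>S. (\<Sum>j\<in>S. M i j * v j) = l * v i)}"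

definition lambda_max :: "'i set \<Rightarrow> ('i \<Rightarrow> 'i \<Rightarrow> real) \<Rightarrow> real" where
  "lambda_max S M = Max (spectrum_on S M)"

definition id_mat :: "'i \<Rightarrow> 'i \<Rightarrow> real" where
  "id_mat i j = (if i = j then 1 else 0)"

text \<open>Meaningful only for matrices that are invertible on \<open>S\<close>, and then unique on \<open>S \<times> S\<close>.\<close>

definition inverse_on :: "'i set \<Rightarrow> ('i \<Rightarrow> 'i \<Rightarrow> real) \<Rightarrow> 'i \<Rightarrow> 'i \<Rightarrow> real" where
  "inverse_on S M = (SOME N. \<forall>i\<in>S. \<forall>k\<in>S.
     (\<Sum>j\<in>S. M i j * N j k) = id_mat i k \<and> (\<Sum>j\<in>S. N i j * M j k) = id_mat i k)"

text \<open>
  Two distinct edges of a simple graph share at most one vertex, so the second sum is \<open>1 / d\<^sub>z\<close> if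
  \<open>e \<inter> e' = {z}\<close>, and \<open>0\<close> if \<open>e\<close> and \<open>e'\<close> are disjoint.
\<close>

definition ricci :: "'a set set \<Rightarrow> 'a set \<Rightarrow> 'a set \<Rightarrow> real" where
  "ricci E e e' =
     (if e = e' then - (\<Sum>z\<in>e. 1 / real (deg E z)) else (\<Sum>z\<in>e \<inter> e'. 1 / real (deg E z)))"

text \<open>
  Replacing the edge \<open>{x, y}\<close> by a path of length \<open>l \<ge> 1\<close>: old vertices are \<open>Inl v\<close>, the new
  ones are \<open>Inr 1, \<dots>, Inr (l - 1)\<close>. For \<open>l = 1\<close> this is a copy of the original graph.
\<close>

definition path_vertex :: "'a \<Rightarrow> 'a \<Rightarrow> nat \<Rightarrow> nat \<Rightarrow> 'a + nat" where
  "path_vertex x y l i = (if i = 0 then Inl x else if i = l then Inl y else Inr i)"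

definition subdivide :: "'a set set \<Rightarrow> 'a \<Rightarrow> 'a \<Rightarrow> nat \<Rightarrow> ('a + nat) set set" where
  "subdivide E x y l =
     (\<lambda>e. Inl ` e) ` (E - {{x, y}}) \<union>
     {{path_vertex x y l i, path_vertex x y l (Suc i)} | i. i < l}"

text \<open>
  The edges of the component of \<open>x\<close> after deletion of \<open>{x, y}\<close>. The branch rooted at \<open>y\<close> and
  its feedback function are obtained by exchanging \<open>x\<close> and \<open>y\<close>. Degrees are always those in the
  undivided graph \<open>E\<close>.
\<close>

definition branch :: "'a set set \<Rightarrow> 'a \<Rightarrow> 'a \<Rightarrow> 'a set set" where
  "branch E x y = {e \<in> E - {{x, y}}. \<forall>v\<in>e. reachable (E - {{x, y}}) x v}"

definition coupling :: "'a set set \<Rightarrow> 'a \<Rightarrow> 'a set \<Rightarrow> real" where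
  "coupling E x e = 1 / real (deg E x) * (if x \<in> e then 1 else 0)"

definition feedback :: "'a set set \<Rightarrow> 'a \<Rightarrow> 'a \<Rightarrow> real \<Rightarrow> real" where
  "feedback E x y l =
     (let S = branch E x y;
          c = coupling E x;
          N = inverse_on S (\<lambda>e e'. l * id_mat e e' - ricci E e e')
      in 2 * (l + 1 / real (deg E x) + 1 / 2 - (\<Sum>e\<in>S. \<Sum>e'\<in>S. c e * N e e' * c e')))"

definition qfun :: "real \<Rightarrow> real" where
  "qfun l = 1 + l - sqrt (l * (l + 2))"

definition lambda_seq :: "'a set set \<Rightarrow> 'a \<Rightarrow> 'a \<Rightarrow> nat \<Rightarrow> real" where
  "lambda_seq E x y l = lambda_max (subdivide E x y l) (ricci (subdivide E x y l))"

end

theory Submission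
  imports "Jordan_Normal_Form.Spectral_Radius" Defs
begin

text \<open>An eigenvector of the subdivided tree for the eigenvalue \<open>m\<close> consists of values on the two
  branches and values \<open>a\<^sub>0, \<dots>, a\<^sub>l\<^sub>-\<^sub>1\<close> along the path. On the path it solves a three-term
  recursion with characteristic roots \<open>q\<close> and \<open>1 / q\<close>, where \<open>q = qfun m < 1\<close>. The
  branches impose \<open>a\<^sub>1 = F a\<^sub>0\<close> and \<open>a\<^sub>l\<^sub>-\<^sub>2 = G a\<^sub>l\<^sub>-\<^sub>1\<close>, and matching both ends yields
  \<open>(F - q) (G - q) = q ^ (2 (l - 2)) (1 - q F) (1 - q G)\<close>, whose right-hand side vanishes in the
  limit. To see that \<open>F\<close> and \<open>G\<close> converge to the feedback functions at the accumulation
  point \<open>l0\<close>, only the resolvents at \<open>l0\<close> itself are needed: the branch equation at \<open>m\<close> is the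
  one at \<open>l0\<close> up to an error of order \<open>m - l0\<close>.\<close>

section \<open>Spectra and resolvents of finite real matrices\<close>

text \<open>An enumeration \<open>f\<close> of \<open>S\<close> carries eigenvectors back and forth
  between functions on \<open>S\<close> and vectors of dimension \<open>n\<close>. The field is
  general because real and complex eigenvalues both occur below.\<close>

lemma eigenvalue_mat_iff:
  fixes M :: "'i \<Rightarrow> 'i \<Rightarrow> 'b::field"
  assumes f: "bij_betw f {0..<n} S"
  shows "eigenvalue (mat n n (\<lambda>(i, j). M (f i) (f j))) k \<longleftrightarrow>
    (\<exists>v. (\<exists>i\<in>S. v i \<noteq> 0) \<and> (\<forall>i\<in>S. (\<Sum>j\<in>S. M i j * v j) = k * v i))"
    (is "eigenvalue ?A k \<longleftrightarrow> (\<exists>v. ?Q v)")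
proof
  have inS: "f i \<in> S" if "i < n" for i
    using f that by (auto simp: bij_betw_def)
  have surj: "\<exists>i<n. f i = s" if "s \<in> S" for s
    using f that by (force simp: bij_betw_def)
  have inj: "inj_on f {0..<n}"
    using f by (simp add: bij_betw_def)
  {
    assume "eigenvalue ?A k"
    then obtain v where v: "v \<in> carrier_vec n" "v \<noteq> 0\<^sub>v n" "?A *\<^sub>v v = k \<cdot>\<^sub>v v"
      by (auto simp: eigenvalue_def eigenvector_def)
    define g where "g = inv_into {0..<n} f"
    have gf: "g (f i) = i" if "i < n" for i
      using that inj by (simp add: g_def)
    define w where "w s = v $ g s" for s
    obtain i where i: "i < n" "v $ i \<noteq> 0"
      using v(1,2) by (metis carrier_vecD eq_vecI index_zero_vec(1,2))
    have "(\<Sum>j\<in>S. M s j * w j) = k * w s" if s: "s \<in> S" for s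
    proof -
      obtain t where t: "t < n" "f t = s"
        using surj[OF s] by blast
      have "(\<Sum>j\<in>S. M s j * w j) = (\<Sum>j\<in>{0..<n}. M (f t) (f j) * v $ j)"
        unfolding sum.reindex_bij_betw[OF f, symmetric] w_def t(2)
        by (rule sum.cong) (auto simp: gf)
      also have "\<dots> = (?A *\<^sub>v v) $ t"
        using t v(1) by (auto simp: scalar_prod_def intro!: sum.cong)
      also have "\<dots> = k * w s"
        using t v(1) by (auto simp: v(3) w_def gf)
      finally show ?thesis .
    qed
    moreover have "w (f i) \<noteq> 0"
      using i by (simp add: w_def gf)
    ultimately show "\<exists>v. ?Q v"
      using inS[OF i(1)] by blast
  }
  {
    assume "\<exists>v. ?Q v"
    then obtain v s where s: "s \<in> S" "v s \<noteq> 0"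
      and v: "\<And>i. i \<in> S \<Longrightarrow> (\<Sum>j\<in>S. M i j * v j) = k * v i"
      by blast
    define w where "w = vec n (\<lambda>i. v (f i))"
    have "?A *\<^sub>v w = k \<cdot>\<^sub>v w"
    proof (rule eq_vecI)
      fix i assume "i < dim_vec (k \<cdot>\<^sub>v w)"
      then have i: "i < n"
        by (simp add: w_def)
      have "(?A *\<^sub>v w) $ i = (\<Sum>j\<in>{0..<n}. M (f i) (f j) * v (f j))"
        using i by (auto simp: w_def scalar_prod_def intro!: sum.cong)
      also have "\<dots> = (\<Sum>j\<in>S. M (f i) j * v j)"
        by (rule sum.reindex_bij_betw[OF f])
      also have "\<dots> = (k \<cdot>\<^sub>v w) $ i"
        using i v[OF inS[OF i]] by (simp add: w_def)
      finally show "(?A *\<^sub>v w) $ i = (k \<cdot>\<^sub>v w) $ i" .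
    qed (simp add: w_def)
    moreover obtain i where "i < n" "f i = s"
      using surj[OF s(1)] by blast
    then have "w $ i \<noteq> 0\<^sub>v n $ i"
      using s by (simp add: w_def)
    then have "w \<noteq> 0\<^sub>v n"
      by auto
    ultimately show "eigenvalue ?A k"
      unfolding eigenvalue_def eigenvector_def by (intro exI[of _ w]) (auto simp: w_def)
  }
qed

text \<open>Together with nonemptiness this makes the \<open>Max\<close> in
  \<open>lambda_max\<close> an attained maximum.\<close>

lemma finite_spectrum_on:
  assumes "finite S"
  shows "finite (spectrum_on S M)"
proof -
  obtain f where "bij_betw f {0..<card S} S"
    using ex_bij_betw_nat_finite[OF assms] by blast
  note iff = eigenvalue_mat_iff[OF this, of M]
  have "spectrum_on S M = spectrum (mat (card S) (card S) (\<lambda>(i, j). M (f i) (f j)))"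
    by (rule Set.set_eqI) (simp only: spectrum_on_def spectrum_def mem_Collect_eq iff)
  then show ?thesis
    by (simp add: card_finite_spectrum(1)[of _ "card S"])
qed

text \<open>A complex eigenvalue always exists; symmetry forces it to be real, and then the real or
  the imaginary part of its eigenvector is a real eigenvector.\<close>

lemma spectrum_on_nonempty:
  fixes M :: "'i \<Rightarrow> 'i \<Rightarrow> real"
  assumes S: "finite S" "S \<noteq> {}"
    and sym: "\<And>i j. i \<in> S \<Longrightarrow> j \<in> S \<Longrightarrow> M i j = M j i"
  shows "spectrum_on S M \<noteq> {}"
proof -
  obtain f where "bij_betw f {0..<card S} S"
    using ex_bij_betw_nat_finite[OF S(1)] by blast
  note iff = eigenvalue_mat_iff[OF this, of "\<lambda>i j. complex_of_real (M i j)"]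
  have "card S > 0"
    using S by (simp add: card_gt_0_iff)
  from spectrum_non_empty[OF mat_carrier this]
  obtain k where "eigenvalue (mat (card S) (card S) (\<lambda>(i, j). complex_of_real (M (f i) (f j)))) k"
    unfolding spectrum_def by blast
  then obtain v s where s: "s \<in> S" "v s \<noteq> 0"
    and v: "\<And>i. i \<in> S \<Longrightarrow> (\<Sum>j\<in>S. complex_of_real (M i j) * v j) = k * v i"
    unfolding iff by blast
  \<comment> \<open>The Hermitian form of \<open>M\<close> at \<open>v\<close>, evaluated twice: the
    eigenvalue equation gives \<open>k\<close> times the squared norm \<open>n\<close>, and symmetry
    makes \<open>Q\<close> its own conjugate.\<close>
  define Q where "Q = (\<Sum>i\<in>S. \<Sum>j\<in>S. cnj (v i) * (complex_of_real (M i j) * v j))"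
  define n where "n = (\<Sum>i\<in>S. (cmod (v i))\<^sup>2)"
  have "0 < (cmod (v s))\<^sup>2"
    using s by simp
  also have "\<dots> \<le> n"
    unfolding n_def by (rule member_le_sum) (use S s in auto)
  finally have n: "n > 0" .
  have "Q = (\<Sum>i\<in>S. cnj (v i) * (k * v i))"
    unfolding Q_def by (rule sum.cong) (simp_all add: sum_distrib_left[symmetric] v)
  also have "\<dots> = (\<Sum>i\<in>S. k * complex_of_real ((cmod (v i))\<^sup>2))"
    by (rule sum.cong) (simp_all only: complex_norm_square mult_ac)
  also have "\<dots> = k * complex_of_real n"
    by (simp only: n_def sum_distrib_left of_real_sum)
  finally have Qk: "Q = k * complex_of_real n" .
  have "cnj Q = (\<Sum>i\<in>S. \<Sum>j\<in>S. v i * (complex_of_real (M i j) * cnj (v j)))"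
    by (simp add: Q_def)
  also have "\<dots> = (\<Sum>j\<in>S. \<Sum>i\<in>S. v i * (complex_of_real (M i j) * cnj (v j)))"
    by (rule sum.swap)
  also have "\<dots> = Q"
    unfolding Q_def by (intro sum.cong refl) (simp add: sym)
  finally have "cnj k * complex_of_real n = k * complex_of_real n"
    by (simp add: Qk)
  then have k: "Im k = 0"
    using n by (simp add: complex_eq_iff)
  have re: "(\<Sum>j\<in>S. M i j * Re (v j)) = Re k * Re (v i)"
    and im: "(\<Sum>j\<in>S. M i j * Im (v j)) = Re k * Im (v i)" if "i \<in> S" for i
    using arg_cong[OF v[OF that], of Re] arg_cong[OF v[OF that], of Im] by (simp_all add: k)
  have "Re (v s) \<noteq> 0 \<or> Im (v s) \<noteq> 0"
    using s(2) by (auto simp: complex_eq_iff)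
  then show ?thesis
  proof
    assume "Re (v s) \<noteq> 0"
    then have "Re k \<in> spectrum_on S M"
      unfolding spectrum_on_def using s(1) re by (intro CollectI exI[of _ "\<lambda>i. Re (v i)"]) auto
    then show ?thesis
      by blast
  next
    assume "Im (v s) \<noteq> 0"
    then have "Re k \<in> spectrum_on S M"
      unfolding spectrum_on_def using s(1) im by (intro CollectI exI[of _ "\<lambda>i. Im (v i)"]) auto
    then show ?thesis
      by blast
  qed
qed

lemma lambda_max_in_spectrum_on:
  assumes "finite S" "S \<noteq> {}" "\<And>i j. i \<in> S \<Longrightarrow> j \<in> S \<Longrightarrow> M i j = M j i"
  shows "lambda_max S M \<in> spectrum_on S M"
  unfolding lambda_max_def
  by (rule Max_in[OF finite_spectrum_on[OF assms(1)] spectrum_on_nonempty[OF assms]])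

text \<open>Outside the spectrum, \<open>l I - M\<close> has trivial kernel, hence nonzero
  determinant and a two-sided inverse. The \<open>SOME\<close> in \<open>inverse_on\<close>
  therefore selects a true inverse.\<close>

lemma inverse_on_left_inverse:
  assumes fin: "finite S" and l: "l \<notin> spectrum_on S M"
    and i: "i \<in> S" and k: "k \<in> S"
  shows "(\<Sum>j\<in>S. inverse_on S (\<lambda>e e'. l * id_mat e e' - M e e') i j *
    (l * id_mat j k - M j k)) = id_mat i k"
proof -
  let ?L = "\<lambda>e e'. l * id_mat e e' - M e e'" and ?n = "card S"
  obtain f where f: "bij_betw f {0..<?n} S"
    using ex_bij_betw_nat_finite[OF fin] by blast
  have inj: "inj_on f {0..<?n}"
    using f by (simp add: bij_betw_def)
  define g where "g = inv_into {0..<?n} f"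
  have gf: "g (f i) = i" if "i < ?n" for i
    using that inj by (simp add: g_def)
  have g: "g s < ?n" "f (g s) = s" if "s \<in> S" for s
    using f that unfolding g_def
    by (metis atLeastLessThan_iff bij_betw_def inv_into_into, metis bij_betw_inv_into_right)
  define A where "A = mat ?n ?n (\<lambda>(i, j). ?L (f i) (f j))"
  have A: "A \<in> carrier_mat ?n ?n"
    by (simp add: A_def)
  have "\<not> eigenvalue A 0"
  proof
    assume "eigenvalue A 0"
    then obtain v where v: "\<exists>i\<in>S. v i \<noteq> 0" "\<And>i. i \<in> S \<Longrightarrow> (\<Sum>j\<in>S. ?L i j * v j) = 0"
      unfolding A_def eigenvalue_mat_iff[OF f, of ?L] by auto
    have "(\<Sum>j\<in>S. M i j * v j) = l * v i" if "i \<in> S" for i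
    proof -
      have "(\<Sum>j\<in>S. ?L i j * v j) = (\<Sum>j\<in>S. if i = j then l * v j else 0) - (\<Sum>j\<in>S. M i j * v j)"
        unfolding sum_subtractf[symmetric]
        by (rule sum.cong) (auto simp: id_mat_def algebra_simps)
      then show ?thesis
        using v(2)[OF that] that fin by simp
    qed
    with v(1) l show False
      by (auto simp: spectrum_on_def)
  qed
  have "det A \<noteq> 0"
  proof
    assume "det A = 0"
    then obtain v where v: "v \<in> carrier_vec ?n" "v \<noteq> 0\<^sub>v ?n" "A *\<^sub>v v = 0\<^sub>v ?n"
      unfolding det_0_iff_vec_prod_zero[OF A] by blast
    moreover have "0 \<cdot>\<^sub>v v = 0\<^sub>v ?n"
      by (rule eq_vecI) (use v(1) in auto)
    ultimately have "eigenvector A v 0"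
      using A by (simp add: eigenvector_def)
    with \<open>\<not> eigenvalue A 0\<close> show False
      by (auto simp: eigenvalue_def)
  qed
  from det_non_zero_imp_unit[OF A this, of "()"]
  obtain B where B: "B \<in> carrier_mat ?n ?n" "A * B = 1\<^sub>m ?n" "B * A = 1\<^sub>m ?n"
    by (auto simp: Units_def ring_mat_def)
  \<comment> \<open>The matrix \<open>B\<close> read back on \<open>S\<close> through the inverse
    enumeration \<open>g\<close>; it witnesses the property under the \<open>SOME\<close>.\<close>
  define N where "N s t = B $$ (g s, g t)" for s t
  have "(\<Sum>j\<in>S. ?L s j * N j t) = id_mat s t \<and> (\<Sum>j\<in>S. N s j * ?L j t) = id_mat s t"
    if st: "s \<in> S" "t \<in> S" for s t
  proof
    have eq: "g s = g t \<longleftrightarrow> s = t"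
      using g st by metis
    have "(\<Sum>j\<in>S. ?L s j * N j t) = (\<Sum>j\<in>{0..<?n}. ?L s (f j) * N (f j) t)"
      by (rule sum.reindex_bij_betw[OF f, symmetric])
    also have "\<dots> = (A * B) $$ (g s, g t)"
      using B(1) g st by (auto simp: A_def N_def scalar_prod_def gf intro!: sum.cong)
    finally show "(\<Sum>j\<in>S. ?L s j * N j t) = id_mat s t"
      using g st eq by (simp add: B(2) id_mat_def)
    have "(\<Sum>j\<in>S. N s j * ?L j t) = (\<Sum>j\<in>{0..<?n}. N s (f j) * ?L (f j) t)"
      by (rule sum.reindex_bij_betw[OF f, symmetric])
    also have "\<dots> = (B * A) $$ (g s, g t)"
      using B(1) g st by (auto simp: A_def N_def scalar_prod_def gf intro!: sum.cong)
    finally show "(\<Sum>j\<in>S. N s j * ?L j t) = id_mat s t"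
      using g st eq by (simp add: B(3) id_mat_def)
  qed
  then have "\<forall>i\<in>S. \<forall>k\<in>S. (\<Sum>j\<in>S. ?L i j * N j k) = id_mat i k \<and>
      (\<Sum>j\<in>S. N i j * ?L j k) = id_mat i k"
    by blast
  from someI[of "\<lambda>N. \<forall>i\<in>S. \<forall>k\<in>S. (\<Sum>j\<in>S. ?L i j * N j k) = id_mat i k \<and>
      (\<Sum>j\<in>S. N i j * ?L j k) = id_mat i k", OF this]
  show ?thesis
    using i k unfolding inverse_on_def by blast
qed

text \<open>Replacing \<open>m\<close> by \<open>l\<close> turns the equation into
  \<open>(l I - M) v = a c + (l - m) v\<close>, which the resolvent \<open>N\<close> solves for
  \<open>v\<close>. For \<open>m\<close> near \<open>l\<close> the term in \<open>v\<close> on the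
  right is absorbed, so \<open>v\<close> is bounded by \<open>a\<close> and vanishes with it. The
  response, the pairing of \<open>c\<close> with \<open>v\<close>, then differs from its value at
  \<open>l\<close> by an error of order \<open>m - l\<close>.\<close>

lemma forced_eigenvector_perturbation:
  fixes M :: "'i \<Rightarrow> 'i \<Rightarrow> real"
  assumes fin: "finite S" and l: "l \<notin> spectrum_on S M"
  defines "N \<equiv> inverse_on S (\<lambda>e e'. l * id_mat e e' - M e e')"
  shows "\<exists>\<delta>>0. \<exists>K. \<forall>m v a. \<bar>m - l\<bar> \<le> \<delta> \<longrightarrow>
    (\<forall>i\<in>S. (\<Sum>j\<in>S. M i j * v j) + c i * a = m * v i) \<longrightarrow>
    (\<Sum>i\<in>S. \<bar>v i\<bar>) \<le> K * \<bar>a\<bar> \<and>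
    \<bar>(\<Sum>i\<in>S. c i * v i) - (\<Sum>i\<in>S. \<Sum>j\<in>S. c i * N i j * c j) * a\<bar> \<le> K * \<bar>m - l\<bar> * \<bar>a\<bar>"
proof -
  \<comment> \<open>The entrywise 1-norm of the resolvent, which bounds the action of
    \<open>N\<close> in the 1-norm, see \<open>Nb\<close>.\<close>
  define k where "k = (\<Sum>i\<in>S. \<Sum>j\<in>S. \<bar>N i j\<bar>)"
  define C where "C = (\<Sum>i\<in>S. \<bar>c i\<bar>)"
  have k0: "k \<ge> 0" and C0: "C \<ge> 0"
    by (auto simp: k_def C_def intro!: sum_nonneg)
  have Nb: "(\<Sum>i\<in>S. \<Sum>j\<in>S. \<bar>N i j\<bar> * \<bar>b j\<bar>) \<le> k * (\<Sum>j\<in>S. \<bar>b j\<bar>)" for b :: "'i \<Rightarrow> real"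
  proof -
    have "(\<Sum>i\<in>S. \<Sum>j\<in>S. \<bar>N i j\<bar> * \<bar>b j\<bar>) \<le> (\<Sum>i\<in>S. \<Sum>j\<in>S. \<bar>N i j\<bar> * (\<Sum>j\<in>S. \<bar>b j\<bar>))"
      by (intro sum_mono mult_left_mono member_le_sum) (use fin in auto)
    then show ?thesis
      by (simp add: k_def sum_distrib_right)
  qed
  \<comment> \<open>This radius gives \<open>k * \<delta> \<le> 1 / 2\<close>, so the term in
    \<open>v\<close> costs at most half of the norm of \<open>v\<close>; the \<open>+ 1\<close>
    covers \<open>k = 0\<close>.\<close>
  define \<delta> where "\<delta> = 1 / (2 * (k + 1))"
  have \<delta>: "\<delta> > 0" "k * \<delta> \<le> 1 / 2"
    using k0 by (auto simp: \<delta>_def field_simps)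
  \<comment> \<open>The first summand is the constant for the norm of \<open>v\<close>, the second
    the one for the response.\<close>
  define K where "K = 2 * k * C + C * k * (2 * k * C)"
  {
    fix m v a
    assume m: "\<bar>m - l\<bar> \<le> \<delta>"
      and v: "\<forall>i\<in>S. (\<Sum>j\<in>S. M i j * v j) + c i * a = m * v i"
    define b where "b i = c i * a + (l - m) * v i" for i
    have Lv: "(\<Sum>j\<in>S. (l * id_mat i j - M i j) * v j) = b i" if i: "i \<in> S" for i
    proof -
      have "(\<Sum>j\<in>S. (l * id_mat i j - M i j) * v j) =
          (\<Sum>j\<in>S. if i = j then l * v j else 0) - (\<Sum>j\<in>S. M i j * v j)"
        unfolding sum_subtractf[symmetric]
        by (rule sum.cong) (auto simp: id_mat_def algebra_simps)
      then show ?thesis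
        using v[rule_format, OF i] i fin by (simp add: b_def algebra_simps)
    qed
    have vN: "v i = (\<Sum>j\<in>S. N i j * b j)" if i: "i \<in> S" for i
    proof -
      have "(\<Sum>j\<in>S. N i j * b j) = (\<Sum>j\<in>S. \<Sum>t\<in>S. N i j * ((l * id_mat j t - M j t) * v t))"
        by (rule sum.cong) (simp_all add: Lv[symmetric] sum_distrib_left)
      also have "\<dots> = (\<Sum>t\<in>S. (\<Sum>j\<in>S. N i j * (l * id_mat j t - M j t)) * v t)"
        by (subst sum.swap) (simp add: sum_distrib_right mult.assoc)
      also have "\<dots> = (\<Sum>t\<in>S. if i = t then v t else 0)"
        by (rule sum.cong)
          (use inverse_on_left_inverse[OF fin l i] in \<open>simp_all add: N_def id_mat_def\<close>)
      finally show ?thesis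
        using fin i by simp
    qed
    define n where "n = (\<Sum>i\<in>S. \<bar>v i\<bar>)"
    have n0: "n \<ge> 0"
      by (auto simp: n_def intro!: sum_nonneg)
    have "n \<le> (\<Sum>i\<in>S. \<Sum>j\<in>S. \<bar>N i j\<bar> * \<bar>b j\<bar>)"
      unfolding n_def
      by (rule sum_mono) (simp add: vN abs_mult[symmetric] sum_abs)
    also have "\<dots> \<le> k * (\<Sum>j\<in>S. \<bar>b j\<bar>)"
      by (rule Nb)
    also have "\<dots> \<le> k * (\<Sum>j\<in>S. \<bar>c j\<bar> * \<bar>a\<bar> + \<bar>l - m\<bar> * \<bar>v j\<bar>)"
      by (intro mult_left_mono sum_mono k0)
        (simp add: b_def abs_mult[symmetric] abs_triangle_ineq)
    also have "\<dots> = k * (C * \<bar>a\<bar> + \<bar>m - l\<bar> * n)"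
      unfolding abs_minus_commute[of l m] C_def n_def sum.distrib
        sum_distrib_left[symmetric] sum_distrib_right[symmetric] ..
    also have "\<dots> = k * C * \<bar>a\<bar> + k * \<bar>m - l\<bar> * n"
      by (simp add: algebra_simps)
    also have "k * \<bar>m - l\<bar> * n \<le> k * \<delta> * n"
      using m k0 n0 by (intro mult_right_mono mult_left_mono)
    also have "k * \<delta> * n \<le> 1 / 2 * n"
      using \<delta> n0 by (intro mult_right_mono)
    finally have n: "n \<le> 2 * k * C * \<bar>a\<bar>"
      by simp
    also have "\<dots> \<le> K * \<bar>a\<bar>"
      using k0 C0 by (intro mult_right_mono) (auto simp: K_def)
    finally have "(\<Sum>i\<in>S. \<bar>v i\<bar>) \<le> K * \<bar>a\<bar>"
      by (simp add: n_def)
    moreover have "\<bar>(\<Sum>i\<in>S. c i * v i) - (\<Sum>i\<in>S. \<Sum>j\<in>S. c i * N i j * c j) * a\<bar>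
        \<le> K * \<bar>m - l\<bar> * \<bar>a\<bar>"
    proof -
      have "(\<Sum>i\<in>S. c i * v i) = (\<Sum>i\<in>S. \<Sum>j\<in>S. c i * N i j * b j)"
        by (rule sum.cong) (simp_all add: vN sum_distrib_left mult_ac)
      also have "\<dots> = (\<Sum>i\<in>S. \<Sum>j\<in>S. c i * N i j * c j * a + c i * ((l - m) * (N i j * v j)))"
        by (intro sum.cong refl) (simp add: b_def algebra_simps)
      \<comment> \<open>The part \<open>c i * a\<close> of \<open>b\<close> produces exactly the
        resolvent form; the remainder carries the factor \<open>l - m\<close>.\<close>
      finally have "(\<Sum>i\<in>S. c i * v i) - (\<Sum>i\<in>S. \<Sum>j\<in>S. c i * N i j * c j) * a =
          (\<Sum>i\<in>S. c i * ((l - m) * (\<Sum>j\<in>S. N i j * v j)))"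
        by (simp add: sum.distrib flip: sum_distrib_left sum_distrib_right)
      also have "\<bar>\<dots>\<bar> \<le> (\<Sum>i\<in>S. C * (\<bar>m - l\<bar> * (\<Sum>j\<in>S. \<bar>N i j\<bar> * \<bar>v j\<bar>)))"
      proof (rule order_trans[OF sum_abs], rule sum_mono)
        fix i assume i: "i \<in> S"
        have "\<bar>c i\<bar> \<le> C"
          unfolding C_def by (rule member_le_sum) (use fin i in auto)
        moreover have "\<bar>\<Sum>j\<in>S. N i j * v j\<bar> \<le> (\<Sum>j\<in>S. \<bar>N i j\<bar> * \<bar>v j\<bar>)"
          by (simp add: abs_mult[symmetric] sum_abs)
        ultimately show "\<bar>c i * ((l - m) * (\<Sum>j\<in>S. N i j * v j))\<bar>
            \<le> C * (\<bar>m - l\<bar> * (\<Sum>j\<in>S. \<bar>N i j\<bar> * \<bar>v j\<bar>))"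
          unfolding abs_mult abs_minus_commute[of m l]
          by (intro mult_mono) (auto simp: C0)
      qed
      also have "\<dots> = C * \<bar>m - l\<bar> * (\<Sum>i\<in>S. \<Sum>j\<in>S. \<bar>N i j\<bar> * \<bar>v j\<bar>)"
        by (simp add: mult.assoc flip: sum_distrib_left)
      also have "\<dots> \<le> C * \<bar>m - l\<bar> * (k * n)"
        unfolding n_def by (intro mult_left_mono Nb) (simp add: C0)
      also have "\<dots> \<le> C * \<bar>m - l\<bar> * (k * (2 * k * C * \<bar>a\<bar>))"
        using n by (intro mult_left_mono) (auto simp: C0 k0)
      also have "\<dots> \<le> K * \<bar>m - l\<bar> * \<bar>a\<bar>"
        using k0 C0 by (auto simp: K_def algebra_simps)
      finally show ?thesis .
    qed
    ultimately have "(\<Sum>i\<in>S. \<bar>v i\<bar>) \<le> K * \<bar>a\<bar> \<and>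
        \<bar>(\<Sum>i\<in>S. c i * v i) - (\<Sum>i\<in>S. \<Sum>j\<in>S. c i * N i j * c j) * a\<bar> \<le> K * \<bar>m - l\<bar> * \<bar>a\<bar>"
      ..
  }
  note bounds = this
  show ?thesis
    by (intro exI[of _ \<delta>] conjI[OF \<delta>(1)] exI[of _ K] allI impI) (rule bounds)
qed

section \<open>The recursion along the path\<close>

text \<open>The square root in \<open>qfun\<close> lies strictly between \<open>l\<close> and
  \<open>l + 1\<close>.\<close>

lemma qfun_bounds:
  assumes "0 < l"
  shows "0 < qfun l" "qfun l < 1"
proof -
  have "sqrt (l * (l + 2)) < sqrt ((l + 1)\<^sup>2)"
    unfolding real_sqrt_less_iff by (simp add: power2_eq_square algebra_simps)
  also have "\<dots> = l + 1"
    using assms by simp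
  finally show "0 < qfun l"
    by (simp add: qfun_def)
  have "l = sqrt (l\<^sup>2)"
    using assms by simp
  also have "\<dots> < sqrt (l * (l + 2))"
    unfolding real_sqrt_less_iff using assms by (simp add: power2_eq_square algebra_simps)
  finally show "qfun l < 1"
    by (simp add: qfun_def)
qed

text \<open>\<open>qfun l\<close> is the smaller root of \<open>t^2 - 2 (1 + l) t + 1\<close>, the
  characteristic polynomial of the recursion along the path; the other root is its
  reciprocal.\<close>

lemma qfun_quadratic:
  assumes "0 < l"
  shows "(qfun l)\<^sup>2 + 1 = 2 * (1 + l) * qfun l"
proof -
  define s where "s = sqrt (l * (l + 2))"
  have "s\<^sup>2 = l * (l + 2)"
    using assms by (simp add: s_def)
  then show ?thesis
    unfolding qfun_def s_def[symmetric] by (simp add: power2_eq_square algebra_simps)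
qed

text \<open>Two adjacent zeros propagate along the recursion. Applied from either end of the path,
  this shows that the end values of an eigenvector are nonzero.\<close>

lemma path_recursion_zero:
  fixes a :: "nat \<Rightarrow> real"
  assumes rec: "\<And>i. i < k \<Longrightarrow> a (Suc (Suc i)) = p * a (Suc i) - a i"
    and "a 0 = 0" "a 1 = 0" "i \<le> Suc k"
  shows "a i = 0"
  using \<open>i \<le> Suc k\<close>
proof (induction i rule: less_induct)
  case (less i)
  consider "i = 0" | "i = 1" | j where "i = Suc (Suc j)"
    by (metis One_nat_def not0_implies_Suc)
  then show ?case
    using assms less by cases auto
qed

text \<open>Along the path, \<open>a\<^sub>i\<^sub>+\<^sub>1 - q a\<^sub>i\<close> is multiplied by \<open>1 / q\<close> and
  \<open>a\<^sub>i - q a\<^sub>i\<^sub>+\<^sub>1\<close> by \<open>q\<close> in each step. Comparing the two ends gives two linear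
  relations between the end values of \<open>a\<close>, and multiplying them eliminates these values.\<close>

lemma path_matching:
  fixes a :: "nat \<Rightarrow> real"
  assumes q: "q\<^sup>2 + 1 = p * q"
    and rec: "\<And>i. i < k \<Longrightarrow> a (Suc (Suc i)) = p * a (Suc i) - a i"
    and F: "a 1 = F * a 0" and G: "a k = G * a (Suc k)"
    and nz: "a 0 \<noteq> 0" "a (Suc k) \<noteq> 0"
  shows "(F - q) * (G - q) = (q ^ k)\<^sup>2 * ((1 - q * F) * (1 - q * G))"
proof -
  have grow: "q ^ i * (a (Suc i) - q * a i) = a 1 - q * a 0" if "i \<le> k" for i
    using that
  proof (induction i)
    case (Suc i)
    have "q * (a (Suc (Suc i)) - q * a (Suc i)) = (p * q - q\<^sup>2) * a (Suc i) - q * a i"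
      by (subst rec) (use Suc.prems in \<open>simp_all add: power2_eq_square algebra_simps\<close>)
    also have "p * q - q\<^sup>2 = 1"
      using q by simp
    finally have "q * (a (Suc (Suc i)) - q * a (Suc i)) = a (Suc i) - q * a i"
      by simp
    then have "q ^ Suc i * (a (Suc (Suc i)) - q * a (Suc i)) = q ^ i * (a (Suc i) - q * a i)"
      unfolding power_Suc2 mult.assoc by simp
    then show ?case
      using Suc by simp
  qed simp
  have shrink: "a i - q * a (Suc i) = q ^ i * (a 0 - q * a 1)" if "i \<le> k" for i
    using that
  proof (induction i)
    case (Suc i)
    have "a (Suc i) - q * a (Suc (Suc i)) = (1 - p * q) * a (Suc i) + q * a i"
      by (subst rec) (use Suc.prems in \<open>simp_all add: algebra_simps\<close>)
    also have "1 - p * q = - q\<^sup>2"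
      using q by simp
    also have "- q\<^sup>2 * a (Suc i) + q * a i = q * (a i - q * a (Suc i))"
      by (simp add: power2_eq_square algebra_simps)
    finally show ?case
      using Suc by simp
  qed simp
  have 1: "(F - q) * a 0 = q ^ k * ((1 - q * G) * a (Suc k))"
    using grow[of k] by (simp add: F[simplified] G algebra_simps)
  have 2: "(G - q) * a (Suc k) = q ^ k * ((1 - q * F) * a 0)"
    using shrink[of k] by (simp add: F[simplified] G algebra_simps)
  have "((F - q) * (G - q)) * (a 0 * a (Suc k)) =
      ((F - q) * a 0) * ((G - q) * a (Suc k))"
    by (simp add: mult_ac)
  also have "\<dots> = ((q ^ k)\<^sup>2 * ((1 - q * F) * (1 - q * G))) * (a 0 * a (Suc k))"
    unfolding 1 2 by (simp add: power2_eq_square mult_ac)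
  finally show ?thesis
    using nz by simp
qed

text \<open>Base and exponent both vary, so a fixed \<rho> below \<open>1\<close> and above the
  limit of the bases is used: it eventually dominates them and makes the powers tend to
  \<open>0\<close>. Then both sides of \<open>eq\<close> pass to the limit.\<close>

lemma matching_limit:
  fixes F G q :: "nat \<Rightarrow> real" and f g :: real
  assumes F: "F \<longlonglongrightarrow> f" and G: "G \<longlonglongrightarrow> g" and q: "q \<longlonglongrightarrow> q0"
    and q0: "q0 < 1" and pos: "\<forall>\<^sub>F n in sequentially. 0 \<le> q n"
    and k: "filterlim k at_top sequentially"
    and eq: "\<forall>\<^sub>F n in sequentially.
      (F n - q n) * (G n - q n) = (q n ^ k n)\<^sup>2 * ((1 - q n * F n) * (1 - q n * G n))"
  shows "(f - q0) * (g - q0) = 0"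
proof -
  obtain \<rho> where \<rho>: "max 0 q0 < \<rho>" "\<rho> < 1"
    using q0 dense[of "max 0 q0" 1] by auto
  have "(\<lambda>n. \<rho> ^ k n) \<longlonglongrightarrow> 0"
    using \<rho> by (intro filterlim_compose[OF LIMSEQ_power_zero k]) auto
  moreover have "\<forall>\<^sub>F n in sequentially. q n < \<rho>"
    using order_tendstoD(2)[OF q, of \<rho>] \<rho> by simp
  then have "\<forall>\<^sub>F n in sequentially. q n ^ k n \<le> \<rho> ^ k n"
    using pos by eventually_elim (auto intro: power_mono)
  moreover have "\<forall>\<^sub>F n in sequentially. 0 \<le> q n ^ k n"
    using pos by eventually_elim auto
  ultimately have z: "(\<lambda>n. q n ^ k n) \<longlonglongrightarrow> 0"
    by (auto intro: tendsto_sandwich[OF _ _ tendsto_const])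
  have "(\<lambda>n. (q n ^ k n)\<^sup>2 * ((1 - q n * F n) * (1 - q n * G n)))
      \<longlonglongrightarrow> 0\<^sup>2 * ((1 - q0 * f) * (1 - q0 * g))"
    by (intro tendsto_intros F G q z)
  then have "(\<lambda>n. (F n - q n) * (G n - q n)) \<longlonglongrightarrow> 0"
    using eq by (simp add: tendsto_cong)
  moreover have "(\<lambda>n. (F n - q n) * (G n - q n)) \<longlonglongrightarrow> (f - q0) * (g - q0)"
    by (intro tendsto_intros F G q)
  ultimately show ?thesis
    using LIMSEQ_unique by blast
qed

section \<open>Subdivided trees\<close>

lemma reachable_refl: "reachable E u u"
  by (simp add: reachable_def)

lemma reachable_trans: "reachable E u v \<Longrightarrow> reachable E v w \<Longrightarrow> reachable E u w"
  unfolding reachable_def by (rule rtrancl_trans)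

lemma reachable_edge: "{a, b} \<in> E \<Longrightarrow> reachable E a b"
  by (auto simp: reachable_def)

lemma reachable_sym:
  assumes "reachable E u v"
  shows "reachable E v u"
proof -
  have "sym {(a, b). {a, b} \<in> E}"
    by (auto simp: sym_def insert_commute)
  then show ?thesis
    using assms unfolding reachable_def by (metis sym_rtrancl symD)
qed

text \<open>Edges are appended one at a time; when the new vertex already lies on the path, the path
  is cut there. Distinctness is what \<open>is_cycle\<close> demands.\<close>

lemma distinct_path_if_reachable:
  assumes "reachable E u v"
  shows "\<exists>vs. vs \<noteq> [] \<and> distinct vs \<and> hd vs = u \<and> last vs = v \<and>
    (\<forall>i. Suc i < length vs \<longrightarrow> {vs ! i, vs ! Suc i} \<in> E)"
  using assms unfolding reachable_def
proof (induction rule: rtrancl_induct)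
  case base
  show ?case
    by (intro exI[of _ "[u]"]) simp
next
  case (step y z)
  then obtain vs where vs: "vs \<noteq> []" "distinct vs" "hd vs = u" "last vs = y"
    and edges: "\<And>i. Suc i < length vs \<Longrightarrow> {vs ! i, vs ! Suc i} \<in> E"
    by blast
  show ?case
  proof (cases "z \<in> set vs")
    case True
    then obtain as bs where split: "vs = as @ z # bs"
      by (meson split_list)
    have "{(as @ [z]) ! i, (as @ [z]) ! Suc i} \<in> E" if "Suc i < length (as @ [z])" for i
      using edges[of i] that by (auto simp: split nth_append less_Suc_eq)
    then show ?thesis
      using vs by (intro exI[of _ "as @ [z]"]) (auto simp: split hd_append split: if_splits)
  next
    case False
    have "{(vs @ [z]) ! i, (vs @ [z]) ! Suc i} \<in> E" if i: "Suc i < length (vs @ [z])" for i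
    proof (cases "Suc i = length vs")
      case True
      then have "vs ! i = y"
        using vs by (metis diff_Suc_1 last_conv_nth)
      then show ?thesis
        using True step(2) by (simp add: nth_append)
    next
      case False
      then show ?thesis
        using edges[of i] i by (simp add: nth_append)
    qed
    then show ?thesis
      using vs False by (intro exI[of _ "vs @ [z]"]) auto
  qed
qed

text \<open>A simple path from \<open>x\<close> to \<open>y\<close> avoiding the edge would close up
  with it to a cycle.\<close>

lemma tree_edge_separates:
  assumes "is_tree V E" "{x, y} \<in> E" "x \<noteq> y"
  shows "\<not> reachable (E - {{x, y}}) x y"
proof
  assume "reachable (E - {{x, y}}) x y"
  then obtain vs where vs: "vs \<noteq> []" "distinct vs" "hd vs = x" "last vs = y"
    and edges: "\<And>i. Suc i < length vs \<Longrightarrow> {vs ! i, vs ! Suc i} \<in> E - {{x, y}}"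
    using distinct_path_if_reachable by metis
  \<comment> \<open>One vertex would give \<open>x = y\<close>, two would make the path the deleted
    edge itself.\<close>
  have "3 \<le> length vs"
  proof (rule ccontr)
    assume "\<not> 3 \<le> length vs"
    then have "length vs = 1 \<or> length vs = 2"
      using length_greater_0_conv[of vs] vs(1) by linarith
    then show False
    proof
      assume "length vs = 1"
      then show False
        using vs assms(3) by (cases vs) auto
    next
      assume len: "length vs = 2"
      then have "vs ! 0 = x" "vs ! 1 = y"
        using vs by (auto simp: hd_conv_nth last_conv_nth)
      then show False
        using edges[of 0] len by simp
    qed
  qed
  then have "is_cycle E vs"
    unfolding is_cycle_def using vs edges assms(2) by (auto simp: insert_commute)
  with assms(1) show False
    by (auto simp: is_tree_def)
qed

lemma ricci_sym: "ricci F e e' = ricci F e' e"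
  by (simp add: ricci_def Int_commute)

section \<open>The two branches at an edge of a tree\<close>

locale tree_edge =
  fixes V :: "'a set" and E :: "'a set set" and x y :: 'a
  assumes tree: "is_tree V E" and xy: "{x, y} \<in> E"
begin

lemma graph: "simple_graph V E"
  using tree by (simp add: is_tree_def)

lemma finite_E: "finite E"
proof -
  have "E \<subseteq> Pow V" "finite V"
    using graph by (auto simp: simple_graph_def)
  then show ?thesis
    by (meson finite_Pow_iff finite_subset)
qed

lemma card_edge: "e \<in> E \<Longrightarrow> card e = 2"
  using graph by (auto simp: simple_graph_def)

lemma xneqy: "x \<noteq> y"
  using card_edge[OF xy] by auto

lemma separated: "\<not> reachable (E - {{x, y}}) x y"
  by (rule tree_edge_separates[OF tree xy xneqy])

text \<open>Interpreting the locale with the ends exchanged yields each fact about the branch at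
  \<open>x\<close> also for the branch at \<open>y\<close>.\<close>

lemma swapped: "tree_edge V E y x"
  using tree xy by (simp add: tree_edge_def insert_commute)

text \<open>The edge itself connects its other end to the component of \<open>x\<close>.\<close>

lemma in_branch_if_meets:
  assumes e: "e \<in> E - {{x, y}}" and v: "v \<in> e" "reachable (E - {{x, y}}) x v"
  shows "e \<in> branch E x y"
proof -
  have "reachable (E - {{x, y}}) x w" if "w \<in> e" for w
  proof (cases "w = v")
    case False
    have "card e = 2"
      using e card_edge by blast
    then have "e = {v, w}"
      using v(1) that False by (auto simp: card_2_iff)
    then have "reachable (E - {{x, y}}) v w"
      using e reachable_edge by metis
    then show ?thesis
      using v(2) reachable_trans by metis
  qed (simp add: v)
  then show ?thesis
    using e by (simp add: branch_def)
qed

text \<open>Along a walk from \<open>x\<close> in the full tree, a use of \<open>{x, y}\<close>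
  lands in \<open>x\<close> or \<open>y\<close>, where reachability starts anew; every other edge
  survives the deletion.\<close>

lemma reachable_from_ends:
  assumes "v \<in> V"
  shows "reachable (E - {{x, y}}) x v \<or> reachable (E - {{x, y}}) y v"
proof -
  have "x \<in> V"
    using graph xy by (auto simp: simple_graph_def)
  then have "(x, v) \<in> {(a, b). {a, b} \<in> E}\<^sup>*"
    using tree assms by (simp add: is_tree_def reachable_def)
  then show ?thesis
  proof (induction rule: rtrancl_induct)
    case base
    show ?case
      by (simp add: reachable_refl)
  next
    case (step u w)
    then have uw: "{u, w} \<in> E"
      by simp
    show ?case
    proof (cases "{u, w} = {x, y}")
      case True
      then have "w = x \<or> w = y"
        by (auto simp: doubleton_eq_iff)
      then show ?thesis
        using reachable_refl by metis
    next
      case False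
      then have "reachable (E - {{x, y}}) u w"
        using uw by (intro reachable_edge) simp
      then show ?thesis
        using step.IH reachable_trans by metis
    qed
  qed
qed

lemma branches_cover: "E - {{x, y}} = branch E x y \<union> branch E y x"
proof -
  interpret sw: tree_edge V E y x
    by (rule swapped)
  have "e \<in> branch E x y \<union> branch E y x" if e: "e \<in> E - {{x, y}}" for e
  proof -
    have "card e = 2" "e \<subseteq> V"
      using e graph by (auto simp: simple_graph_def)
    then obtain v where v: "v \<in> e" "v \<in> V"
      by (metis card.empty ex_in_conv in_mono zero_neq_numeral)
    with reachable_from_ends[OF v(2)] e show ?thesis
      using in_branch_if_meets[of e v] sw.in_branch_if_meets[of e v] by (auto simp: insert_commute)
  qed
  then show ?thesis
    by (auto simp: branch_def insert_commute)
qed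

text \<open>A common vertex would connect \<open>x\<close> with \<open>y\<close> without their edge.
  Disjointness of the edges as vertex sets makes the Ricci entries between the branches
  vanish.\<close>

lemma branches_disjoint:
  assumes "e \<in> branch E x y" "e' \<in> branch E y x"
  shows "e \<inter> e' = {}"
proof (rule ccontr)
  assume "e \<inter> e' \<noteq> {}"
  then obtain v where "v \<in> e" "v \<in> e'"
    by blast
  then have "reachable (E - {{x, y}}) x v" "reachable (E - {{x, y}}) y v"
    using assms by (auto simp: branch_def insert_commute)
  then show False
    using separated reachable_sym reachable_trans by metis
qed

lemma far_end_notin_branch: "e \<in> branch E x y \<Longrightarrow> y \<notin> e"
  using separated by (auto simp: branch_def)

lemma branch_subset: "branch E x y \<subseteq> E"
  by (auto simp: branch_def)

lemma finite_branch: "finite (branch E x y)"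
  using branch_subset finite_E finite_subset by blast

lemma branch_inter: "branch E x y \<inter> branch E y x = {}"
proof -
  have False if "e \<in> branch E x y" "e \<in> branch E y x" for e
    using branches_disjoint[OF that] card_edge[of e] branch_subset that by auto
  then show ?thesis
    by blast
qed

end

section \<open>Edges and degrees of the subdivided tree\<close>

text \<open>With length \<open>k + 2\<close> the end edges \<open>0\<close> and \<open>k + 1\<close>
  of the path are distinct, and the three-term recursion holds at the \<open>k\<close> edges between
  them.\<close>

locale subdivided_tree = tree_edge +
  fixes k l :: nat
  defines "l \<equiv> Suc (Suc k)"
begin

abbreviation pv :: "nat \<Rightarrow> 'a + nat" where
  "pv \<equiv> path_vertex x y l"

text \<open>Written as an image, so that injectivity of \<open>pv\<close> reduces equality and
  intersection of path edges to their indices.\<close>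

definition path_edge :: "nat \<Rightarrow> ('a + nat) set" where
  "path_edge i = pv ` {i, Suc i}"

abbreviation E' :: "('a + nat) set set" where
  "E' \<equiv> subdivide E x y l"

definition weight :: "nat \<Rightarrow> real" where
  "weight i = 1 / real (deg E' (pv i))"

lemma inj_pv: "inj_on pv {..l}"
  using xneqy by (auto simp: inj_on_def path_vertex_def split: if_splits)

lemma Inl_in_path_edge:
  "i < l \<Longrightarrow> Inl z \<in> path_edge i \<longleftrightarrow> (z = x \<and> i = 0) \<or> (z = y \<and> i = Suc k)"
  by (auto simp: path_edge_def path_vertex_def l_def split: if_splits)

lemma Inr_in_path_edge:
  "i < l \<Longrightarrow> 0 < j \<Longrightarrow> j < l \<Longrightarrow> Inr j \<in> path_edge i \<longleftrightarrow> j = i \<or> j = Suc i"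
  by (auto simp: path_edge_def path_vertex_def l_def split: if_splits)

text \<open>Length at least \<open>2\<close> puts a new vertex on every path edge.\<close>

lemma path_edge_neq_image: "i < l \<Longrightarrow> path_edge i \<noteq> Inl ` e"
proof -
  assume i: "i < l"
  have "Inr (if i = 0 then 1 else i) \<in> path_edge i"
    using i by (auto simp: path_edge_def path_vertex_def l_def)
  then show ?thesis
    by auto
qed

lemma subdivide_eq:
  "E' = (`) Inl ` branch E x y \<union> (`) Inl ` branch E y x \<union> path_edge ` {..<l}"
  unfolding subdivide_def branches_cover path_edge_def by auto

lemma finite_subdivide: "finite E'"
proof -
  interpret sw: tree_edge V E y x
    by (rule swapped)
  show ?thesis
    unfolding subdivide_eq by (simp add: finite_branch sw.finite_branch)
qed

lemma path_edge_Int: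
  assumes "i < l" "j < l"
  shows "path_edge i \<inter> path_edge j = pv ` ({i, Suc i} \<inter> {j, Suc j})"
  unfolding path_edge_def using assms by (intro inj_on_image_Int[OF inj_pv, symmetric]) auto

lemma path_edge_eq_iff:
  assumes "i < l" "j < l"
  shows "path_edge i = path_edge j \<longleftrightarrow> i = j"
proof -
  have "path_edge i = path_edge j \<longleftrightarrow> {i, Suc i} = {j, Suc j}"
    unfolding path_edge_def using assms by (intro inj_on_image_eq_iff[OF inj_pv]) auto
  then show ?thesis
    by (auto simp: doubleton_eq_iff)
qed

lemma in_subdivide_iff:
  "f \<in> E' \<longleftrightarrow> (\<exists>e\<in>E - {{x, y}}. f = Inl ` e) \<or> (\<exists>i<l. f = path_edge i)"
  unfolding subdivide_eq branches_cover by auto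

text \<open>The edges at an old vertex correspond to those before subdivision, with
  \<open>{x, y}\<close> replaced by the end edge of the path at that vertex.\<close>

lemma deg_old: "deg E' (Inl z) = deg E z"
proof -
  \<comment> \<open>Index of the end edge at \<open>z\<close>: the first if \<open>z = x\<close>,
    the last if \<open>z = y\<close>.\<close>
  define t where "t = (if z = x then 0 else Suc k)"
  define \<phi> where "\<phi> e = (if e = {x, y} then path_edge t else Inl ` e)" for e
  have t: "t < l"
    by (simp add: t_def l_def)
  have "bij_betw \<phi> {e \<in> E. z \<in> e} {f \<in> E'. Inl z \<in> f}"
  proof (rule bij_betwI')
    fix e e' assume "e \<in> {e \<in> E. z \<in> e}" "e' \<in> {e \<in> E. z \<in> e}"
    show "\<phi> e = \<phi> e' \<longleftrightarrow> e = e'"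
      using path_edge_neq_image[OF t] path_edge_neq_image[OF t, symmetric]
      by (auto simp: \<phi>_def inj_image_eq_iff)
  next
    fix e assume "e \<in> {e \<in> E. z \<in> e}"
    then show "\<phi> e \<in> {f \<in> E'. Inl z \<in> f}"
      using t by (auto simp: \<phi>_def in_subdivide_iff Inl_in_path_edge t_def)
  next
    fix f assume f: "f \<in> {f \<in> E'. Inl z \<in> f}"
    then consider e where "e \<in> E - {{x, y}}" "f = Inl ` e" | i where "i < l" "f = path_edge i"
      by (auto simp: in_subdivide_iff)
    then show "\<exists>e\<in>{e \<in> E. z \<in> e}. f = \<phi> e"
    proof cases
      case 1
      then show ?thesis
        using f by (intro bexI[of _ e]) (auto simp: \<phi>_def)
    next
      case 2
      then have "(z = x \<and> i = 0) \<or> (z = y \<and> i = Suc k)"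
        using f by (simp add: Inl_in_path_edge)
      then show ?thesis
        using 2 xy xneqy by (intro bexI[of _ "{x, y}"]) (auto simp: \<phi>_def t_def)
    qed
  qed
  then show ?thesis
    unfolding deg_def by (rule bij_betw_same_card[symmetric])
qed

lemma deg_new:
  assumes "0 < i" "i < l"
  shows "deg E' (Inr i) = 2"
proof -
  obtain j where j: "i = Suc j"
    using assms(1) gr0_implies_Suc by blast
  then have "j < l"
    using assms(2) by simp
  then have "path_edge j \<in> E'" "path_edge (Suc j) \<in> E'"
    using assms(2) j by (auto simp: subdivide_eq)
  moreover have "f = path_edge j \<or> f = path_edge (Suc j)" if f: "f \<in> E'" "Inr i \<in> f" for f
  proof -
    obtain n where "n < l" "f = path_edge n"
      using f by (auto simp: in_subdivide_iff)
    then show ?thesis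
      using Inr_in_path_edge[of n i] assms f(2) j by auto
  qed
  ultimately have "{f \<in> E'. Inr i \<in> f} = {path_edge j, path_edge (Suc j)}"
    using Inr_in_path_edge[of j i] Inr_in_path_edge[of "Suc j" i] assms j \<open>j < l\<close> by auto
  then show ?thesis
    unfolding deg_def using assms j by (simp add: path_edge_eq_iff)
qed

lemma weight_eq:
  "weight 0 = 1 / real (deg E x)" "weight l = 1 / real (deg E y)"
  "0 < i \<Longrightarrow> i < l \<Longrightarrow> weight i = 1 / 2"
  by (simp_all add: weight_def path_vertex_def deg_old deg_new) (simp_all add: l_def deg_old)

section \<open>Entries of the Ricci matrix of the subdivided tree\<close>

lemma ricci_old_old: "ricci E' (Inl ` e) (Inl ` e') = ricci E e e'"
  by (simp add: ricci_def inj_image_eq_iff image_Int[symmetric] sum.reindex deg_old)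

text \<open>An old edge meets the path only at \<open>x\<close> on the first edge or at
  \<open>y\<close> on the last. Writing the entry as a sum of two conditionals lets row sums
  collapse term by term.\<close>

lemma ricci_old_path:
  assumes "j < l"
  shows "ricci E' (Inl ` e) (path_edge j) =
    (if j = 0 then coupling E x e else 0) + (if j = Suc k then coupling E y e else 0)"
proof -
  define Z where
    "Z = (if j = 0 \<and> x \<in> e then {x} else if j = Suc k \<and> y \<in> e then {y} else {})"
  have "Inl z \<in> Inl ` e \<inter> path_edge j \<longleftrightarrow> Inl z \<in> (Inl ` Z :: ('a + nat) set)" for z
    using Inl_in_path_edge[OF assms, of z] by (auto simp: Z_def)
  then have "Inl ` e \<inter> path_edge j = Inl ` Z"
    by blast
  then have "ricci E' (Inl ` e) (path_edge j) = (\<Sum>z\<in>Z. 1 / real (deg E z))"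
    using path_edge_neq_image[OF assms, symmetric, of e]
    by (simp add: ricci_def sum.reindex deg_old)
  then show ?thesis
    by (simp add: Z_def coupling_def)
qed

text \<open>The path block is tridiagonal. Each diagonal is a separate conditional, so that row sums
  over \<open>j\<close> collapse; \<open>Suc j = i\<close> avoids subtraction of indices.\<close>

lemma ricci_path_path:
  assumes "i < l" "j < l"
  shows "ricci E' (path_edge i) (path_edge j) =
    (if j = i then - (weight i + weight (Suc i)) else 0) +
    (if j = Suc i then weight (Suc i) else 0) + (if Suc j = i then weight i else 0)"
proof -
  have sum_pv: "(\<Sum>z\<in>pv ` K. 1 / real (deg E' z)) = sum weight K" if "K \<subseteq> {..l}" for K
    using that inj_on_subset[OF inj_pv that] by (simp add: sum.reindex weight_def)
  have int: "{i, Suc i} \<inter> {j, Suc j} =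
      (if j = i then {i, Suc i} else if j = Suc i then {Suc i} else if Suc j = i then {i} else {})"
    by auto
  show ?thesis
  proof (cases "i = j")
    case True
    then have "ricci E' (path_edge i) (path_edge j) = - sum weight {i, Suc i}"
      using assms sum_pv[of "{i, Suc i}"] by (simp add: ricci_def path_edge_def)
    then show ?thesis
      using True by simp
  next
    case False
    moreover have "{i, Suc i} \<inter> {j, Suc j} \<subseteq> {..l}"
      using assms by auto
    ultimately have "ricci E' (path_edge i) (path_edge j) = sum weight ({i, Suc i} \<inter> {j, Suc j})"
      using assms sum_pv[of "{i, Suc i} \<inter> {j, Suc j}"]
      by (simp add: ricci_def path_edge_eq_iff path_edge_Int)
    then show ?thesis
      using False unfolding int by auto
  qed
qed

lemma sum_subdivide:
  fixes f :: "('a + nat) set \<Rightarrow> real"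
  shows "sum f E' = (\<Sum>e\<in>branch E x y. f (Inl ` e)) + (\<Sum>e\<in>branch E y x. f (Inl ` e)) +
    (\<Sum>i<l. f (path_edge i))"
proof -
  interpret sw: tree_edge V E y x
    by (rule swapped)
  have inj: "inj_on ((`) Inl) S" for S :: "'a set set"
    by (auto simp: inj_on_def inj_image_eq_iff)
  have disj: "(`) Inl ` branch E x y \<inter> (`) (Inl :: 'a \<Rightarrow> 'a + nat) ` branch E y x = {}"
    using branch_inter by (auto simp: inj_image_eq_iff)
  have disj': "((`) Inl ` branch E x y \<union> (`) Inl ` branch E y x) \<inter> path_edge ` {..<l} = {}"
    using path_edge_neq_image path_edge_neq_image[symmetric] by (auto 0 3)
  have "inj_on path_edge {..<l}"
    by (auto simp: inj_on_def path_edge_eq_iff)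
  then show ?thesis
    unfolding subdivide_eq
    by (simp add: sum.union_disjoint disj disj' sum.reindex inj finite_branch sw.finite_branch)
qed

text \<open>These are the rows of the eigenvalue equation, block by block. A branch row sees the
  path only through its end edge. The row of an end edge, whose new vertex has weight
  \<open>1 / 2\<close>, is doubled and solved for the neighbouring value; an interior row, with
  diagonal \<open>-1\<close> and off-diagonal entries \<open>1 / 2\<close>, gives the
  recursion.\<close>

lemma eigenvector_equations:
  assumes "m \<in> spectrum_on E' (ricci E')"
  shows "\<exists>(u :: 'a set \<Rightarrow> real) (a :: nat \<Rightarrow> real).
    ((\<exists>e\<in>branch E x y. u e \<noteq> 0) \<or> (\<exists>e\<in>branch E y x. u e \<noteq> 0) \<or> (\<exists>i\<le>Suc k. a i \<noteq> 0)) \<and>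
    (\<forall>e\<in>branch E x y.
      (\<Sum>e'\<in>branch E x y. ricci E e e' * u e') + coupling E x e * a 0 = m * u e) \<and>
    (\<forall>e\<in>branch E y x.
      (\<Sum>e'\<in>branch E y x. ricci E e e' * u e') + coupling E y e * a (Suc k) = m * u e) \<and>
    a 1 = 2 * (m + 1 / real (deg E x) + 1 / 2) * a 0 -
      2 * (\<Sum>e\<in>branch E x y. coupling E x e * u e) \<and>
    a k = 2 * (m + 1 / real (deg E y) + 1 / 2) * a (Suc k) -
      2 * (\<Sum>e\<in>branch E y x. coupling E y e * u e) \<and>
    (\<forall>i<k. a (Suc (Suc i)) = 2 * (1 + m) * a (Suc i) - a i)"
proof -
  interpret sw: tree_edge V E y x
    by (rule swapped)
  obtain v where nz: "\<exists>f\<in>E'. v f \<noteq> 0"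
    and v: "\<And>f. f \<in> E' \<Longrightarrow> (\<Sum>f'\<in>E'. ricci E' f f' * v f') = m * v f"
    using assms unfolding spectrum_on_def by blast
  define u where "u e = v (Inl ` e)" for e
  define a where "a i = v (path_edge i)" for i
  have l: "{..<l} = {..Suc k}"
    by (auto simp: l_def)
  have far: "coupling E y e = 0" if "e \<in> branch E x y" for e
    using far_end_notin_branch[OF that] by (simp add: coupling_def)
  have far': "coupling E x e = 0" if "e \<in> branch E y x" for e
    using sw.far_end_notin_branch[OF that] by (simp add: coupling_def)
  have cross: "ricci E e e' = 0" "ricci E e' e = 0" if "e \<in> branch E x y" "e' \<in> branch E y x" for e e'
    using branches_disjoint[OF that] branch_inter that by (auto simp: ricci_def Int_commute)
  \<comment> \<open>One equation for all old edges, with both couplings; on each branch,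
    \<open>cross\<close> together with \<open>far\<close> or \<open>far'\<close> removes the terms
    belonging to the other one.\<close>
  have old: "(\<Sum>e'\<in>branch E x y. ricci E e e' * u e') + (\<Sum>e'\<in>branch E y x. ricci E e e' * u e') +
      (coupling E x e * a 0 + coupling E y e * a (Suc k)) = m * u e" if "e \<in> E - {{x, y}}" for e
  proof -
    have "(\<Sum>i<l. ricci E' (Inl ` e) (path_edge i) * a i) =
        (\<Sum>i<l. (if i = 0 then coupling E x e * a 0 else 0) +
          (if i = Suc k then coupling E y e * a (Suc k) else 0))"
      by (rule sum.cong) (auto simp: ricci_old_path)
    also have "\<dots> = coupling E x e * a 0 + coupling E y e * a (Suc k)"
      by (simp add: sum.distrib l)
    finally show ?thesis
      using v[of "Inl ` e"] that
      by (auto simp: sum_subdivide in_subdivide_iff ricci_old_old u_def a_def)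
  qed
  \<comment> \<open>The row of an arbitrary path edge; the first, last and interior cases are
    specialised below.\<close>
  have path: "(\<Sum>e\<in>branch E x y. if i = 0 then coupling E x e * u e else 0) +
      (\<Sum>e\<in>branch E y x. if i = Suc k then coupling E y e * u e else 0) +
      (\<Sum>j\<le>Suc k. (if j = i then - (weight i + weight (Suc i)) * a i else 0) +
        (if j = Suc i then weight (Suc i) * a (Suc i) else 0) +
        (if Suc j = i then weight i * a j else 0)) = m * a i" if i: "i \<le> Suc k" for i
  proof -
    have i': "i < l"
      using i by (simp add: l_def)
    have "(\<Sum>e\<in>branch E x y. if i = 0 then coupling E x e * u e else 0) =
        (\<Sum>e\<in>branch E x y. ricci E' (path_edge i) (Inl ` e) * u e)"
      by (rule sum.cong) (auto simp: ricci_sym[of E' "path_edge i"] ricci_old_path i' far)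
    moreover have "(\<Sum>e\<in>branch E y x. if i = Suc k then coupling E y e * u e else 0) =
        (\<Sum>e\<in>branch E y x. ricci E' (path_edge i) (Inl ` e) * u e)"
      by (rule sum.cong) (auto simp: ricci_sym[of E' "path_edge i"] ricci_old_path i' far')
    moreover have "(\<Sum>j\<le>Suc k. (if j = i then - (weight i + weight (Suc i)) * a i else 0) +
        (if j = Suc i then weight (Suc i) * a (Suc i) else 0) +
        (if Suc j = i then weight i * a j else 0)) =
        (\<Sum>j<l. ricci E' (path_edge i) (path_edge j) * a j)"
      unfolding l[symmetric] by (rule sum.cong) (auto simp: ricci_path_path i')
    moreover have "path_edge i \<in> E'"
      using i' by (auto simp: in_subdivide_iff)
    ultimately show ?thesis
      using v[of "path_edge i"] by (simp add: sum_subdivide u_def a_def)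
  qed
  have nz': "(\<exists>e\<in>branch E x y. u e \<noteq> 0) \<or> (\<exists>e\<in>branch E y x. u e \<noteq> 0) \<or> (\<exists>i\<le>Suc k. a i \<noteq> 0)"
    using nz by (auto simp: subdivide_eq u_def a_def l)
  have A: "(\<Sum>e'\<in>branch E x y. ricci E e e' * u e') + coupling E x e * a 0 = m * u e"
    if e: "e \<in> branch E x y" for e
    using old[of e] e unfolding branches_cover by (simp add: cross far)
  have B: "(\<Sum>e'\<in>branch E y x. ricci E e e' * u e') + coupling E y e * a (Suc k) = m * u e"
    if e: "e \<in> branch E y x" for e
    using old[of e] e unfolding branches_cover by (simp add: cross far')
  \<comment> \<open>\<open>Suc 0\<close> and \<open>Suc k\<close> index new vertices, the same one
    if \<open>k = 0\<close>, while \<open>Suc (Suc k)\<close> indexes the end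
    \<open>y\<close>.\<close>
  have w: "weight (Suc 0) = 1 / 2" "weight (Suc k) = 1 / 2" "weight (Suc (Suc k)) = 1 / real (deg E y)"
    using weight_eq by (simp_all add: l_def)
  have P0: "a 1 = 2 * (m + 1 / real (deg E x) + 1 / 2) * a 0 - 2 * (\<Sum>e\<in>branch E x y. coupling E x e * u e)"
    unfolding weight_eq(1)[symmetric] using path[of 0]
    by (simp add: sum.distrib w algebra_simps del: sum.atMost_Suc)
  have Pk: "a k = 2 * (m + 1 / real (deg E y) + 1 / 2) * a (Suc k) - 2 * (\<Sum>e\<in>branch E y x. coupling E y e * u e)"
    unfolding w(3)[symmetric] using path[of "Suc k"]
    by (simp add: sum.distrib w(1,2) algebra_simps del: sum.atMost_Suc)
  have Pi: "a (Suc (Suc i)) = 2 * (1 + m) * a (Suc i) - a i" if "i < k" for i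
    using path[of "Suc i"] that
    by (simp add: sum.distrib weight_eq l_def algebra_simps del: sum.atMost_Suc)
  show ?thesis
    by (intro exI[of _ u] exI[of _ a] conjI ballI allI impI) (fact nz' A B P0 Pk Pi)+
qed

end

section \<open>Matching at large length\<close>

context tree_edge
begin

text \<open>\<open>F\<close> and \<open>G\<close> are the ratios \<open>a 1 / a 0\<close> and
  \<open>a k / a (Suc k)\<close> of an eigenvector. Both \<delta> and \<open>K\<close> are fixed
  before \<open>m\<close> and \<open>k\<close>, since both of these move in the limit.\<close>

lemma matching_of_eigenvalue:
  assumes A: "l0 \<notin> spectrum_on (branch E x y) (ricci E)"
    and B: "l0 \<notin> spectrum_on (branch E y x) (ricci E)"
  shows "\<exists>\<delta>>0. \<exists>K. \<forall>m k. 0 < m \<longrightarrow> \<bar>m - l0\<bar> \<le> \<delta> \<longrightarrow>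
    m \<in> spectrum_on (subdivide E x y (Suc (Suc k))) (ricci (subdivide E x y (Suc (Suc k)))) \<longrightarrow>
    (\<exists>F G. \<bar>F - feedback E x y l0\<bar> \<le> K * \<bar>m - l0\<bar> \<and> \<bar>G - feedback E y x l0\<bar> \<le> K * \<bar>m - l0\<bar> \<and>
      (F - qfun m) * (G - qfun m) = (qfun m ^ k)\<^sup>2 * ((1 - qfun m * F) * (1 - qfun m * G)))"
proof -
  interpret sw: tree_edge V E y x
    by (rule swapped)
  define gA where "gA = (\<Sum>e\<in>branch E x y. \<Sum>e'\<in>branch E x y. coupling E x e *
    inverse_on (branch E x y) (\<lambda>e e'. l0 * id_mat e e' - ricci E e e') e e' * coupling E x e')"
  define gB where "gB = (\<Sum>e\<in>branch E y x. \<Sum>e'\<in>branch E y x. coupling E y e *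
    inverse_on (branch E y x) (\<lambda>e e'. l0 * id_mat e e' - ricci E e e') e e' * coupling E y e')"
  have feedback: "feedback E x y l0 = 2 * (l0 + 1 / real (deg E x) + 1 / 2 - gA)"
    "feedback E y x l0 = 2 * (l0 + 1 / real (deg E y) + 1 / 2 - gB)"
    by (simp_all add: feedback_def Let_def gA_def gB_def)
  obtain \<delta>A KA where \<delta>A: "\<delta>A > 0" and KA:
    "\<forall>m v a. \<bar>m - l0\<bar> \<le> \<delta>A \<longrightarrow>
      (\<forall>e\<in>branch E x y. (\<Sum>e'\<in>branch E x y. ricci E e e' * v e') + coupling E x e * a = m * v e) \<longrightarrow>
      (\<Sum>e\<in>branch E x y. \<bar>v e\<bar>) \<le> KA * \<bar>a\<bar> \<and>
      \<bar>(\<Sum>e\<in>branch E x y. coupling E x e * v e) - gA * a\<bar> \<le> KA * \<bar>m - l0\<bar> * \<bar>a\<bar>"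
    using forced_eigenvector_perturbation[OF finite_branch A, of "coupling E x"]
    unfolding gA_def[symmetric] by (elim exE conjE)
  obtain \<delta>B KB where \<delta>B: "\<delta>B > 0" and KB:
    "\<forall>m v a. \<bar>m - l0\<bar> \<le> \<delta>B \<longrightarrow>
      (\<forall>e\<in>branch E y x. (\<Sum>e'\<in>branch E y x. ricci E e e' * v e') + coupling E y e * a = m * v e) \<longrightarrow>
      (\<Sum>e\<in>branch E y x. \<bar>v e\<bar>) \<le> KB * \<bar>a\<bar> \<and>
      \<bar>(\<Sum>e\<in>branch E y x. coupling E y e * v e) - gB * a\<bar> \<le> KB * \<bar>m - l0\<bar> * \<bar>a\<bar>"
    using forced_eigenvector_perturbation[OF sw.finite_branch B, of "coupling E y"]
    unfolding gB_def[symmetric] by (elim exE conjE)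
  \<comment> \<open>The feedback expression changes by \<open>2 * (m - l0)\<close> and by twice the
    error of the quotient \<open>s / b\<close>; \<open>max KA KB\<close> lets one bound serve both
    ends.\<close>
  define K where "K = 2 + 2 * max KA KB"
  have error: "\<bar>2 * (m + d + 1 / 2) - 2 * (s / b) - 2 * (l0 + d + 1 / 2 - g)\<bar> \<le> K * \<bar>m - l0\<bar>"
    if "\<bar>s - g * b\<bar> \<le> C * \<bar>m - l0\<bar> * \<bar>b\<bar>" "b \<noteq> 0" "C \<le> max KA KB" for m d s b g C
  proof -
    have "\<bar>s / b - g\<bar> * \<bar>b\<bar> = \<bar>s - g * b\<bar>"
      using that(2) by (simp add: abs_mult[symmetric] algebra_simps)
    then have "\<bar>s / b - g\<bar> \<le> C * \<bar>m - l0\<bar>"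
      using that(1,2) by (metis mult_le_cancel_right_pos zero_less_abs_iff)
    also have "\<dots> \<le> max KA KB * \<bar>m - l0\<bar>"
      using that(3) by (rule mult_right_mono) simp
    finally have "2 * \<bar>m - l0\<bar> + 2 * \<bar>s / b - g\<bar> \<le> K * \<bar>m - l0\<bar>"
      by (simp add: K_def distrib_right)
    moreover have "2 * (m + d + 1 / 2) - 2 * (s / b) - 2 * (l0 + d + 1 / 2 - g) =
        2 * (m - l0) - 2 * (s / b - g)"
      by (simp add: algebra_simps)
    moreover have "\<bar>2 * (m - l0) - 2 * (s / b - g)\<bar> \<le> 2 * \<bar>m - l0\<bar> + 2 * \<bar>s / b - g\<bar>"
      using abs_triangle_ineq4[of "2 * (m - l0)" "2 * (s / b - g)"] by (simp only: abs_mult abs_numeral)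
    ultimately show ?thesis
      by simp
  qed
  have min: "min \<delta>A \<delta>B > 0"
    using \<delta>A \<delta>B by simp
  show ?thesis
  proof (rule exI[of _ "min \<delta>A \<delta>B"], rule conjI[OF min], rule exI[of _ K], intro allI impI)
    fix m :: real and k :: nat
    let ?E' = "subdivide E x y (Suc (Suc k))"
    assume m: "0 < m" "\<bar>m - l0\<bar> \<le> min \<delta>A \<delta>B" and spec: "m \<in> spectrum_on ?E' (ricci ?E')"
    interpret subdivided_tree V E x y k "Suc (Suc k)"
      by unfold_locales
    obtain u a where nz: "(\<exists>e\<in>branch E x y. u e \<noteq> 0) \<or> (\<exists>e\<in>branch E y x. u e \<noteq> 0) \<or> (\<exists>i\<le>Suc k. a i \<noteq> 0)"
      and uA: "\<forall>e\<in>branch E x y.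
        (\<Sum>e'\<in>branch E x y. ricci E e e' * u e') + coupling E x e * a 0 = m * u e"
      and uB: "\<forall>e\<in>branch E y x.
        (\<Sum>e'\<in>branch E y x. ricci E e e' * u e') + coupling E y e * a (Suc k) = m * u e"
      and aA: "a 1 = 2 * (m + 1 / real (deg E x) + 1 / 2) * a 0 -
        2 * (\<Sum>e\<in>branch E x y. coupling E x e * u e)"
      and aB: "a k = 2 * (m + 1 / real (deg E y) + 1 / 2) * a (Suc k) -
        2 * (\<Sum>e\<in>branch E y x. coupling E y e * u e)"
      and rec: "\<forall>i<k. a (Suc (Suc i)) = 2 * (1 + m) * a (Suc i) - a i"
      using eigenvector_equations[OF spec] by (elim exE conjE)
    have mA: "\<bar>m - l0\<bar> \<le> \<delta>A" and mB: "\<bar>m - l0\<bar> \<le> \<delta>B"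
      using m(2) by auto
    note bA = KA[rule_format, OF mA uA[rule_format]] and bB = KB[rule_format, OF mB uB[rule_format]]
    \<comment> \<open>Without forcing, the norm bound kills all values on the branch.\<close>
    have zA: "u e = 0" if "a 0 = 0" "e \<in> branch E x y" for e
    proof -
      have "\<bar>u e\<bar> \<le> (\<Sum>e\<in>branch E x y. \<bar>u e\<bar>)"
        by (rule member_le_sum) (use that finite_branch in auto)
      then show ?thesis
        using bA[THEN conjunct1] that(1) by simp
    qed
    have zB: "u e = 0" if "a (Suc k) = 0" "e \<in> branch E y x" for e
    proof -
      have "\<bar>u e\<bar> \<le> (\<Sum>e\<in>branch E y x. \<bar>u e\<bar>)"
        by (rule member_le_sum) (use that sw.finite_branch in auto)
      then show ?thesis
        using conjunct1[OF bB] that(1) by simp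
    qed
    \<comment> \<open>Otherwise the branch at \<open>x\<close>, then \<open>a 1\<close>, then the
      whole path and with it the other branch would vanish.\<close>
    have a0: "a 0 \<noteq> 0"
    proof
      assume 0: "a 0 = 0"
      then have "a 1 = 0"
        using aA zA by simp
      then have "a i = 0" if "i \<le> Suc k" for i
        using path_recursion_zero[of k a "2 * (1 + m)" i] rec 0 that by simp
      then show False
        using nz zA zB by auto
    qed
    \<comment> \<open>The recursion is invariant under reversal, so zeros at the end
      \<open>y\<close> would propagate back to \<open>a 0\<close>.\<close>
    have aS: "a (Suc k) \<noteq> 0"
    proof
      assume 0: "a (Suc k) = 0"
      then have 1: "a k = 0"
        using aB zB by simp
      have "a (Suc k - i) = 0" if "i \<le> Suc k" for i
      proof (rule path_recursion_zero[of k "\<lambda>i. a (Suc k - i)" "2 * (1 + m)" i])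
        fix i assume "i < k"
        then show "a (Suc k - Suc (Suc i)) = 2 * (1 + m) * a (Suc k - Suc i) - a (Suc k - i)"
          using rec[rule_format, of "k - Suc i"] \<open>i < k\<close> by (simp add: Suc_diff_Suc Suc_diff_le less_imp_le)
      qed (use 0 1 that in simp_all)
      from this[of "Suc k"] show False
        using a0 by simp
    qed
    \<comment> \<open>By \<open>aA\<close> this is \<open>a 1 / a 0\<close>, in the shape that
      \<open>error\<close> bounds; likewise for \<open>G\<close> with \<open>aB\<close>.\<close>
    define F where "F = 2 * (m + 1 / real (deg E x) + 1 / 2) -
      2 * ((\<Sum>e\<in>branch E x y. coupling E x e * u e) / a 0)"
    define G where "G = 2 * (m + 1 / real (deg E y) + 1 / 2) -
      2 * ((\<Sum>e\<in>branch E y x. coupling E y e * u e) / a (Suc k))"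
    have "\<bar>F - feedback E x y l0\<bar> \<le> K * \<bar>m - l0\<bar>"
      unfolding F_def feedback by (rule error[OF conjunct2[OF bA] a0 max.cobounded1])
    moreover have "\<bar>G - feedback E y x l0\<bar> \<le> K * \<bar>m - l0\<bar>"
      unfolding G_def feedback by (rule error[OF conjunct2[OF bB] aS max.cobounded2])
    moreover have "(F - qfun m) * (G - qfun m) =
        (qfun m ^ k)\<^sup>2 * ((1 - qfun m * F) * (1 - qfun m * G))"
    proof (rule path_matching[OF qfun_quadratic[OF m(1)], where a = a])
      show "a (Suc (Suc i)) = 2 * (1 + m) * a (Suc i) - a i" if "i < k" for i
        using rec that by simp
      show "a 1 = F * a 0"
        using a0 unfolding aA F_def by (simp add: left_diff_distrib)
      show "a k = G * a (Suc k)"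
        using aS unfolding aB G_def by (simp add: left_diff_distrib)
    qed (use a0 aS in simp_all)
    ultimately show "\<exists>F G. \<bar>F - feedback E x y l0\<bar> \<le> K * \<bar>m - l0\<bar> \<and>
        \<bar>G - feedback E y x l0\<bar> \<le> K * \<bar>m - l0\<bar> \<and>
        (F - qfun m) * (G - qfun m) =
          (qfun m ^ k)\<^sup>2 * ((1 - qfun m * F) * (1 - qfun m * G))"
      by blast
  qed
qed

text \<open>The matrix is symmetric on a finite nonempty edge set, so its largest eigenvalue is
  attained.\<close>

lemma lambda_seq_in_spectrum:
  "lambda_seq E x y (Suc (Suc k)) \<in>
    spectrum_on (subdivide E x y (Suc (Suc k))) (ricci (subdivide E x y (Suc (Suc k))))"
proof -
  interpret subdivided_tree V E x y k "Suc (Suc k)"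
    by unfold_locales
  have "subdivide E x y (Suc (Suc k)) \<noteq> {}"
    using subdivide_eq by (auto simp: lessThan_Suc)
  then show ?thesis
    unfolding lambda_seq_def
    by (rule lambda_max_in_spectrum_on[OF finite_subdivide]) (rule ricci_sym)
qed

end

section \<open>Passage to the limit along a subsequence\<close>

theorem corollary2:
  fixes V :: "'a set" and E :: "'a set set" and x y :: 'a
    and lminus lplus lstar :: real and r :: "nat \<Rightarrow> nat"
  assumes "is_tree V E"
    and "{x, y} \<in> E"
    and "0 < lminus" and "lminus \<le> lplus"
    and "\<forall>\<^sub>F l in sequentially. lambda_seq E x y l \<in> {lminus..lplus}"
    and "strict_mono r" and "(\<lambda>n. lambda_seq E x y (r n)) \<longlonglongrightarrow> lstar"
    and "lstar \<notin> spectrum_on (branch E x y) (ricci E) \<union> spectrum_on (branch E y x) (ricci E)"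
  shows "(feedback E x y lstar - qfun lstar) * (feedback E y x lstar - qfun lstar) = 0"
proof -
  interpret tree_edge V E x y
    using assms(1,2) by unfold_locales
  define m where "m = (\<lambda>n. lambda_seq E x y (r n))"
  have m: "m \<longlonglongrightarrow> lstar"
    using assms(7) by (simp add: m_def)
  have r: "filterlim r at_top sequentially"
    by (rule filterlim_subseq[OF assms(6)])
  \<comment> \<open>The lower end of the interval keeps the limit positive, and hence
    \<open>qfun lstar < 1\<close>.\<close>
  have mlow: "\<forall>\<^sub>F n in sequentially. lminus \<le> m n"
    using eventually_compose_filterlim[OF assms(5) r] by eventually_elim (simp add: m_def)
  have lstar: "0 < lstar"
    using tendsto_lowerbound[OF m mlow] assms(3) by simp
  have "lstar \<notin> spectrum_on (branch E x y) (ricci E)" "lstar \<notin> spectrum_on (branch E y x) (ricci E)"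
    using assms(8) by simp_all
  from matching_of_eigenvalue[OF this]
  obtain \<delta> K where \<delta>: "\<delta> > 0" and match:
    "\<forall>m k. 0 < m \<longrightarrow> \<bar>m - lstar\<bar> \<le> \<delta> \<longrightarrow>
    m \<in> spectrum_on (subdivide E x y (Suc (Suc k))) (ricci (subdivide E x y (Suc (Suc k)))) \<longrightarrow>
    (\<exists>F G. \<bar>F - feedback E x y lstar\<bar> \<le> K * \<bar>m - lstar\<bar> \<and> \<bar>G - feedback E y x lstar\<bar> \<le> K * \<bar>m - lstar\<bar> \<and>
      (F - qfun m) * (G - qfun m) = (qfun m ^ k)\<^sup>2 * ((1 - qfun m * F) * (1 - qfun m * G)))"
    by (elim exE conjE)
  \<comment> \<open>The matching data at index \<open>n\<close>; \<open>r n - 2\<close> is the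
    \<open>k\<close> belonging to length \<open>r n\<close> as soon as
    \<open>2 \<le> r n\<close>.\<close>
  define P where "P n F G \<longleftrightarrow> \<bar>F - feedback E x y lstar\<bar> \<le> K * \<bar>m n - lstar\<bar> \<and>
      \<bar>G - feedback E y x lstar\<bar> \<le> K * \<bar>m n - lstar\<bar> \<and>
      (F - qfun (m n)) * (G - qfun (m n)) =
        (qfun (m n) ^ (r n - 2))\<^sup>2 * ((1 - qfun (m n) * F) * (1 - qfun (m n) * G))" for n F G
  have "\<forall>\<^sub>F n in sequentially. \<bar>m n - lstar\<bar> \<le> \<delta>"
    using tendstoD[OF m \<delta>] by eventually_elim (simp add: dist_real_def)
  moreover have "\<forall>\<^sub>F n in sequentially. 2 \<le> r n"
    using r by (simp add: filterlim_at_top)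
  ultimately have ev: "\<forall>\<^sub>F n in sequentially. \<exists>F G. P n F G"
    using mlow
  proof eventually_elim
    case (elim n)
    then obtain k where k: "r n = Suc (Suc k)"
      by (metis add_2_eq_Suc le_Suc_ex)
    show ?case
      using match[rule_format, of "m n" k] elim assms(3) lambda_seq_in_spectrum[of k] by (simp add: P_def m_def k)
  qed
  \<comment> \<open>\<open>G\<close> is chosen after \<open>F\<close>, so that eventually both
    satisfy the same instance of \<open>P\<close>.\<close>
  define F where "F n = (SOME F. \<exists>G. P n F G)" for n
  define G where "G n = (SOME G. P n (F n) G)" for n
  have P: "\<forall>\<^sub>F n in sequentially. P n (F n) (G n)"
    using ev
  proof eventually_elim
    case (elim n)
    then have "\<exists>G. P n (F n) G"
      unfolding F_def by (rule someI_ex)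
    then show ?case
      unfolding G_def by (rule someI_ex)
  qed
  \<comment> \<open>This null sequence dominates the errors of \<open>F\<close> and
    \<open>G\<close>.\<close>
  have lim0: "(\<lambda>n. K * \<bar>m n - lstar\<bar>) \<longlonglongrightarrow> 0"
    using m by (auto intro!: tendsto_eq_intros)
  have "(\<lambda>n. F n - feedback E x y lstar) \<longlonglongrightarrow> 0"
  proof (rule tendsto_0_le[OF lim0, where K = 1])
    show "\<forall>\<^sub>F n in sequentially.
        norm (F n - feedback E x y lstar) \<le> norm (K * \<bar>m n - lstar\<bar>) * 1"
      using P by (rule eventually_mono) (simp add: P_def del: abs_mult, linarith)
  qed
  moreover have "(\<lambda>n. G n - feedback E y x lstar) \<longlonglongrightarrow> 0"
  proof (rule tendsto_0_le[OF lim0, where K = 1])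
    show "\<forall>\<^sub>F n in sequentially.
        norm (G n - feedback E y x lstar) \<le> norm (K * \<bar>m n - lstar\<bar>) * 1"
      using P by (rule eventually_mono) (simp add: P_def del: abs_mult, linarith)
  qed
  ultimately have "F \<longlonglongrightarrow> feedback E x y lstar" "G \<longlonglongrightarrow> feedback E y x lstar"
    by (simp_all add: LIM_zero_iff)
  moreover have "(\<lambda>n. qfun (m n)) \<longlonglongrightarrow> qfun lstar"
    unfolding qfun_def by (intro tendsto_intros m)
  moreover have "\<forall>\<^sub>F n in sequentially. 0 \<le> qfun (m n)"
    using mlow
  proof eventually_elim
    case (elim n)
    then show ?case
      using qfun_bounds(1)[of "m n"] assms(3) by simp
  qed
  moreover have "filterlim (\<lambda>n. r n - 2) at_top sequentially"
    by (rule filterlim_compose[OF filterlim_minus_const_nat_at_top r])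
  moreover have "\<forall>\<^sub>F n in sequentially. (F n - qfun (m n)) * (G n - qfun (m n)) =
      (qfun (m n) ^ (r n - 2))\<^sup>2 * ((1 - qfun (m n) * F n) * (1 - qfun (m n) * G n))"
    using P by eventually_elim (simp add: P_def)
  ultimately show ?thesis
    using qfun_bounds(2)[OF lstar] by (intro matching_limit)
qed

end
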